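(* Let $m\ge3$ be odd and let $\tau^{(n)}$ be as defined in the context. For every $n\ge1$, if $\tau^{(n)}(v_1,\dots,v_n)=(t_1,\dots,t_n)$ then $$v_n=\Bigl(2^{n-1}t_n-\sum_{j=1}^{n-1}2^{j-1}t_j\Bigr)\bmod m.$$
   Context: Fix an odd $m\ge3$ and $c=2^{-1}\bmod m=(m+1)/2$. Define maps $\tau^{(n)}:\{0,\dots,m-1\}^n\to\{0,\dots,m-1\}^n$ recursively: $\tau^{(1)}$ is the identity, and for $n\ge2$, $\tau^{(n)}(v_1,\dots,v_n)=\bigl(v_1,\ \tau^{(n-1)}(c(v_1+v_2)\bmod m,\dots,c(v_1+v_n)\bmod m)\bigr)$. *)

theory Defs
  imports Main
begin

definition half :: "int \<Rightarrow> int" where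
  "half m = (m + 1) div 2"

lemma half_inverse_of_2:
  assumes "odd m" "m \<ge> 3"
  shows "half m \<in> {0..<m}" and "2 * half m mod m = 1"
proof -
  have *: "2 * half m = m + 1"
    using assms(1) unfolding half_def by presburger
  show "half m \<in> {0..<m}"
    using * assms(2) by simp
  show "2 * half m mod m = 1"
    unfolding * using assms(2) by (simp add: mod_add_self1)
qed

text \<open>
  A tuple \<open>(v\<^sub>1, \<dots>, v\<^sub>n)\<close> is a list of length \<open>n\<close>, so \<open>v\<^sub>i\<close> is \<open>vs ! (i - 1)\<close> and
  \<open>tau m\<close> restricted to lists of length \<open>n\<close> is \<open>\<tau>\<^bsup>(n)\<^esup>\<close>.
  The equation for the empty list (\<open>n = 0\<close>) is only there for totality.
\<close>

fun tau :: "int \<Rightarrow> int list \<Rightarrow> int list" where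
  "tau m [] = []"
| "tau m [v] = [v]"
| "tau m (v # w # vs) = v # tau m (map (\<lambda>x. half m * (v + x) mod m) (w # vs))"

lemma length_tau: "length (tau m vs) = length vs"
  by (induction m vs rule: tau.induct) auto

lemma set_tau:
  assumes "m > 0" "set vs \<subseteq> {0..<m}"
  shows "set (tau m vs) \<subseteq> {0..<m}"
  using assms
proof (induction m vs rule: tau.induct)
  case (3 m v w vs)
  have "set (map (\<lambda>x. half m * (v + x) mod m) (w # vs)) \<subseteq> {0..<m}"
    using "3.prems"(1) by auto
  then have "set (tau m (map (\<lambda>x. half m * (v + x) mod m) (w # vs))) \<subseteq> {0..<m}"
    by (rule "3.IH"[OF "3.prems"(1)])
  then show ?case using "3.prems"(2) by simp
qed auto

end

theory Submission
  imports Defs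
begin

text \<open>
  Since \<open>2 * half m\<close> is 1 modulo \<open>m\<close>, the last entry \<open>x\<close> of the input is recovered from the
  last entry \<open>u\<close> of the list passed to the recursive call as \<open>2 * u - v\<close>, where \<open>v\<close> is the first
  entry. Doubling the formula for \<open>u\<close> shifts its powers of two by one, and \<open>- v\<close> supplies the
  new first term of the sum.
\<close>

lemma dvd_last_diff_tau:
  assumes "odd m" "vs \<noteq> []"
  shows "m dvd last vs - (2 ^ (length vs - 1) * tau m vs ! (length vs - 1)
    - (\<Sum>j<length vs - 1. 2 ^ j * tau m vs ! j))"
  using assms
proof (induction m vs rule: tau.induct)
  case (3 m v w vs)
  define us where "us = map (\<lambda>x. half m * (v + x) mod m) (w # vs)"
  define x where "x = last (w # vs)"
  define k where "k = length vs"
  define t where "t = tau m us"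
  \<comment> \<open>\<open>us\<close> has length \<open>Suc k\<close>, so its last position is
    \<open>k\<close>.\<close>
  have IH: "m dvd last us - (2 ^ k * t ! k - (\<Sum>j<k. 2 ^ j * t ! j))"
    using "3.IH" "3.prems" by (simp add: us_def t_def k_def)
  have "last us = half m * (v + x) mod m"
    unfolding us_def x_def by (subst last_map) auto
  then have "m dvd half m * (v + x) - last us"
    by (simp add: dvd_minus_mod)
  then have "m dvd 2 * (half m * (v + x) - last us)"
    by (rule dvd_mult)
  \<comment> \<open>\<open>2 * half m\<close> is exactly \<open>m + 1\<close>, which exposes a
    multiple of \<open>m\<close> to discard.\<close>
  also have "2 * (half m * (v + x) - last us) = m * (v + x) + (v + x - 2 * last us)"
  proof -
    have "2 * half m = m + 1"
      using "3.prems"(1) unfolding half_def by presburger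
    then have "2 * (half m * (v + x)) = (m + 1) * (v + x)"
      by (metis mult.assoc)
    then show ?thesis by (simp add: algebra_simps)
  qed
  finally have "m dvd v + x - 2 * last us"
    by (simp add: dvd_add_right_iff)
  \<comment> \<open>Adding twice the induction hypothesis cancels \<open>last us\<close>.\<close>
  then have "m dvd (v + x - 2 * last us)
      + 2 * (last us - (2 ^ k * t ! k - (\<Sum>j<k. 2 ^ j * t ! j)))"
    using IH by (intro dvd_add dvd_mult)
  \<comment> \<open>Position 0 of \<open>v # t\<close> is split off; entry \<open>j\<close> of
    \<open>t\<close> is entry \<open>Suc j\<close> of \<open>v # t\<close>.\<close>
  also have "\<dots> = x - (2 ^ Suc k * (v # t) ! Suc k - (\<Sum>j<Suc k. 2 ^ j * (v # t) ! j))"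
    unfolding sum.lessThan_Suc_shift by (simp add: algebra_simps sum_distrib_left)
  finally show ?case
    by (simp add: us_def t_def k_def x_def del: sum.lessThan_Suc)
qed auto

theorem theorem9:
  fixes m :: int and n :: nat and vs ts :: "int list"
  assumes "m \<ge> 3" and "odd m"
    and "n \<ge> 1"
    and "length vs = n" and "set vs \<subseteq> {0..m - 1}"
    and "tau m vs = ts"
  shows "vs ! (n - 1) =
    (2 ^ (n - 1) * ts ! (n - 1) - (\<Sum>j = 1..n - 1. 2 ^ (j - 1) * ts ! (j - 1))) mod m"
proof -
  have ne: "vs \<noteq> []"
    using assms(3,4) by auto
  then have last: "last vs = vs ! (n - 1)"
    using assms(4) by (simp add: last_conv_nth)
  have sum: "(\<Sum>j = 1..n - 1. 2 ^ (j - 1) * ts ! (j - 1)) = (\<Sum>j<n - 1. 2 ^ j * ts ! j)"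
    by (rule sum.reindex_bij_witness[of _ Suc "\<lambda>j. j - 1"]) auto
  have "last vs \<in> {0..m - 1}"
    using last_in_set[OF ne] assms(5) by blast
  \<comment> \<open>An entry in this range is its own residue, so the congruence becomes an
    equality.\<close>
  then have "vs ! (n - 1) = vs ! (n - 1) mod m"
    by (simp add: last)
  also have "\<dots> = (2 ^ (n - 1) * ts ! (n - 1) - (\<Sum>j<n - 1. 2 ^ j * ts ! j)) mod m"
    using dvd_last_diff_tau[OF assms(2) ne] unfolding assms(4,6) last
    by (simp add: mod_eq_dvd_iff)
  finally show ?thesis
    unfolding sum .
qed

end
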